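(* The square-root map $$\varPhi:(\Delta,\mathcal{G}^{\mathrm{FR}})\longrightarrow(\mathcal{U},\mathcal{G}^{\ell^2}),\qquad (p_n)\mapsto(\sqrt{p_n}),$$ is an isometry; that is, $\varPhi$ is a diffeomorphism and $\mathcal{G}^{\ell^2}_{\varPhi(p)}\big(d\varPhi_p v,\,d\varPhi_p w\big)=\mathcal{G}^{\mathrm{FR}}_p(v,w)$ for all $p\in\Delta$ and all $v,w\in T_p\Delta$.
   Context: Sequences are indexed by $n\in\mathbb{N}=\{0,1,2,\dots\}$. Let $\ell^2_{\mathbb{R}}$ be the Hilbert space of real square-summable sequences with $\langle (x_n),(y_n)\rangle_{\ell^2}=\sum_{n=0}^\infty x_ny_n$, and $\ell^1_{\mathbb{R}}$ the space of real absolutely summable sequences. Let $\mathbb{S}(\ell^2_{\mathbb{R}})$ be the unit sphere of $\ell^2_{\mathbb{R}}$, with tangent spaces $T_x\mathbb{S}(\ell^2_{\mathbb{R}})=\{v\in\ell^2_{\mathbb{R}}:\langle x,v\rangle_{\ell^2}=0\}$. The round metric $\mathcal{G}^{\ell^2}$ is the restriction of $\langle\cdot,\cdot\rangle_{\ell^2}$ to these tangent spaces. Let $$\mathcal{U}=\{(x_n)\in\mathbb{S}(\ell^2_{\mathbb{R}}): x_n>0\ \ \forall n\in\mathbb{N}\},$$ with tangent spaces $T_x\mathcal{U}=T_x\mathbb{S}(\ell^2_{\mathbb{R}})$ and the metric $\mathcal{G}^{\ell^2}$. The $\ell^2$-probability simplex is $\Delta=\{(p_n)\in\ell^1_{\mathbb{R}}:\sum_{n=0}^\infty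 p_n=1,\ p_n>0\ \forall n\in\mathbb{N}\}$. It carries the differentiable structure for which the bijection $(p_n)\mapsto(\sqrt{p_n})$, $\Delta\to\mathcal{U}$, is a diffeomorphism. The tangent spaces are $$T_{(p_n)}\Delta=\Big\{(v_n)\in\ell^1_{\mathbb{R}}:\ \sum_{n=0}^\infty v_n=0,\ \Big(\tfrac{v_n}{\sqrt{p_n}}\Big)\in\ell^2_{\mathbb{R}}\Big\},$$ where a tangent vector is identified with the componentwise derivative of a curve, so that $d\varPhi_p$ is computed componentwise. The $\ell^2$-Fisher–Rao metric is $$\mathcal{G}^{\mathrm{FR}}_{(p_n)}\big((v_n),(w_n)\big)=\frac14\sum_{n=0}^\infty\frac{v_nw_n}{p_n},\qquad (v_n),(w_n)\in T_{(p_n)}\Delta.$$ *)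

theory Defs
  imports "HOL-Analysis.Analysis"
begin

section \<open>The sequence spaces\<close>

definition ell1 :: "(nat \<Rightarrow> real) set"
  where "ell1 = {x. summable (\<lambda>n. \<bar>x n\<bar>)}"

definition square_summable :: "(nat \<Rightarrow> real) set"
  where "square_summable = {x. summable (\<lambda>n. (x n)\<^sup>2)}"

lemma square_summableI: "summable (\<lambda>n. (x n)\<^sup>2) \<Longrightarrow> x \<in> square_summable"
  and square_summableD: "x \<in> square_summable \<Longrightarrow> summable (\<lambda>n. (x n)\<^sup>2)"
  by (auto simp: square_summable_def)

lemma square_summable_mult:
  assumes "x \<in> square_summable" "y \<in> square_summable"
  shows "summable (\<lambda>n. x n * y n)"
proof (rule summable_comparison_test')
  show "summable (\<lambda>n. (x n)\<^sup>2 + (y n)\<^sup>2)"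
    using assms by (intro summable_add square_summableD)
  show "norm (x n * y n) \<le> (x n)\<^sup>2 + (y n)\<^sup>2" if "n \<ge> 0" for n
  proof -
    have "0 \<le> (\<bar>x n\<bar> - \<bar>y n\<bar>)\<^sup>2" "0 \<le> \<bar>x n\<bar> * \<bar>y n\<bar>"
      by simp_all
    then have "\<bar>x n\<bar> * \<bar>y n\<bar> \<le> (x n)\<^sup>2 + (y n)\<^sup>2"
      unfolding power2_diff power2_abs by linarith
    then show ?thesis
      by (simp add: abs_mult)
  qed
qed

lemma square_summable_zero: "(\<lambda>n. 0) \<in> square_summable"
  by (simp add: square_summable_def)

lemma square_summable_scale:
  assumes "x \<in> square_summable"
  shows "(\<lambda>n. c * x n) \<in> square_summable"
  using assms by (auto simp: square_summable_def power_mult_distrib intro: summable_mult)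

lemma square_summable_add:
  assumes "x \<in> square_summable" "y \<in> square_summable"
  shows "(\<lambda>n. x n + y n) \<in> square_summable"
proof (rule square_summableI)
  have "summable (\<lambda>n. (x n)\<^sup>2 + (y n)\<^sup>2 + 2 * (x n * y n))"
    using assms by (intro summable_add summable_mult square_summable_mult square_summableD)
  then show "summable (\<lambda>n. (x n + y n)\<^sup>2)"
    by (simp add: power2_sum mult.assoc)
qed

typedef ell2 = square_summable
  morphisms coord Ell2
  using square_summable_zero by blast

lemma coord_square_summable [simp]: "coord x \<in> square_summable"
  by (rule coord)

lemma summable_coord_mult [simp]: "summable (\<lambda>n. coord x n * coord y n)"
  by (rule square_summable_mult) simp_all

lemma ell2_eqI: "(\<And>n. coord x n = coord y n) \<Longrightarrow> x = y"
  by (metis coord_inject ext)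

instantiation ell2 :: real_vector
begin

definition "0 = Ell2 (\<lambda>n. 0)"
definition "x + y = Ell2 (\<lambda>n. coord x n + coord y n)"
definition "r *\<^sub>R x = Ell2 (\<lambda>n. r * coord x n)"
definition "- x = Ell2 (\<lambda>n. - coord x n)" for x :: ell2
definition "x - y = Ell2 (\<lambda>n. coord x n - coord y n)"

lemma coord_zero [simp]: "coord 0 n = 0"
  by (simp add: zero_ell2_def Ell2_inverse square_summable_zero)

lemma coord_add [simp]: "coord (x + y) n = coord x n + coord y n"
  by (simp add: plus_ell2_def Ell2_inverse square_summable_add)

lemma coord_scaleR [simp]: "coord (r *\<^sub>R x) n = r * coord x n"
  by (simp add: scaleR_ell2_def Ell2_inverse square_summable_scale)

lemma coord_minus [simp]: "coord (- x) n = - coord x n"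
  using square_summable_scale[of "coord x" "-1"] by (simp add: uminus_ell2_def Ell2_inverse)

lemma coord_diff [simp]: "coord (x - y) n = coord x n - coord y n"
  using square_summable_add[of "coord x" "\<lambda>n. -1 * coord y n"]
    square_summable_scale[of "coord y" "-1"]
  by (simp add: minus_ell2_def Ell2_inverse)

instance
  by standard (auto intro!: ell2_eqI simp: algebra_simps)

end

instantiation ell2 :: real_inner
begin

definition inner_ell2 :: "ell2 \<Rightarrow> ell2 \<Rightarrow> real"
  where "inner_ell2 x y = (\<Sum>n. coord x n * coord y n)"

definition norm_ell2 :: "ell2 \<Rightarrow> real"
  where "norm_ell2 x = sqrt (x \<bullet> x)"

definition sgn_ell2 :: "ell2 \<Rightarrow> ell2"
  where "sgn_ell2 x = x /\<^sub>R norm x"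

definition dist_ell2 :: "ell2 \<Rightarrow> ell2 \<Rightarrow> real"
  where "dist_ell2 x y = norm (x - y)"

definition uniformity_ell2 :: "(ell2 \<times> ell2) filter"
  where "uniformity_ell2 = (INF e\<in>{0 <..}. principal {(x, y). dist x y < e})"

definition open_ell2 :: "ell2 set \<Rightarrow> bool"
  where "open_ell2 U \<longleftrightarrow> (\<forall>x\<in>U. eventually (\<lambda>(x', y). x' = x \<longrightarrow> y \<in> U) uniformity)"

instance
proof
  fix x y z :: ell2 and r :: real
  show "inner x y = inner y x"
    by (simp add: inner_ell2_def mult.commute)
  show "inner (x + y) z = inner x z + inner y z"
    by (simp add: inner_ell2_def distrib_right suminf_add)
  show "inner (r *\<^sub>R x) y = r * inner x y"
    by (simp add: inner_ell2_def mult.assoc suminf_mult)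
  show "0 \<le> inner x x"
    by (simp add: inner_ell2_def suminf_nonneg)
  show "inner x x = 0 \<longleftrightarrow> x = 0"
  proof
    assume "inner x x = 0"
    then have "\<forall>n. coord x n * coord x n = 0"
      by (simp add: inner_ell2_def suminf_eq_zero_iff)
    then show "x = 0"
      by (intro ell2_eqI) simp
  qed (simp add: inner_ell2_def)
qed (simp_all add: norm_ell2_def sgn_ell2_def dist_ell2_def uniformity_ell2_def open_ell2_def)

end

lemma power2_norm_ell2: "(norm x)\<^sup>2 = (\<Sum>n. (coord x n)\<^sup>2)"
  by (simp add: power2_norm_eq_inner inner_ell2_def) (simp add: power2_eq_square)

lemma norm_ell2_sum_le: "(\<Sum>n<N. (coord x n)\<^sup>2) \<le> (norm x)\<^sup>2"
proof -
  have "(\<Sum>n<N. coord x n * coord x n) \<le> (\<Sum>n. coord x n * coord x n)"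
    by (intro sum_le_suminf) auto
  then show ?thesis
    by (simp add: power2_norm_ell2 flip: power2_eq_square)
qed

lemma abs_coord_le_norm: "\<bar>coord x n\<bar> \<le> norm x"
proof -
  have "(coord x n)\<^sup>2 \<le> (\<Sum>k<Suc n. (coord x k)\<^sup>2)"
    by (intro member_le_sum) auto
  also have "\<dots> \<le> (norm x)\<^sup>2"
    by (rule norm_ell2_sum_le)
  finally show ?thesis
    using abs_le_square_iff[of "coord x n" "norm x"] by simp
qed

lemma ell2_of_bounded_partial_sums:
  assumes "\<And>N. (\<Sum>n<N. (f n)\<^sup>2) \<le> B\<^sup>2" "0 \<le> B"
  shows "f \<in> square_summable" "norm (Ell2 f) \<le> B"
proof -
  have s: "summable (\<lambda>n. (f n)\<^sup>2)"
    using assms(1) by (intro summableI_nonneg_bounded) auto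
  then show f: "f \<in> square_summable"
    by (rule square_summableI)
  have "(norm (Ell2 f))\<^sup>2 = (\<Sum>n. (f n)\<^sup>2)"
    by (simp add: power2_norm_ell2 Ell2_inverse f)
  also have "\<dots> \<le> B\<^sup>2"
    by (rule suminf_le_const[OF s assms(1)])
  finally show "norm (Ell2 f) \<le> B"
    using assms(2) by (rule power2_le_imp_le)
qed

instance ell2 :: banach
proof
  fix X :: "nat \<Rightarrow> ell2"
  assume X: "Cauchy X"
  have "Cauchy (\<lambda>i. coord (X i) n)" for n
  proof (rule metric_CauchyI)
    fix e :: real assume "0 < e"
    then obtain M where M: "\<And>i j. i \<ge> M \<Longrightarrow> j \<ge> M \<Longrightarrow> dist (X i) (X j) < e"
      using X by (meson metric_CauchyD)
    have "dist (coord (X i) n) (coord (X j) n) \<le> dist (X i) (X j)" for i j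
      using abs_coord_le_norm[of "X i - X j" n] by (simp add: dist_norm)
    then show "\<exists>M. \<forall>i\<ge>M. \<forall>j\<ge>M. dist (coord (X i) n) (coord (X j) n) < e"
      using M by (meson le_less_trans)
  qed
  then have "\<forall>n. \<exists>l. (\<lambda>i. coord (X i) n) \<longlonglongrightarrow> l"
    using Cauchy_convergent convergent_def by blast
  then obtain L where L: "\<And>n. (\<lambda>i. coord (X i) n) \<longlonglongrightarrow> L n"
    by metis
  have key: "\<exists>M. \<forall>i\<ge>M. (\<lambda>n. coord (X i) n - L n) \<in> square_summable
      \<and> norm (Ell2 (\<lambda>n. coord (X i) n - L n)) \<le> e" if e: "0 < e" for e
  proof -
    obtain M where M: "\<And>i j. i \<ge> M \<Longrightarrow> j \<ge> M \<Longrightarrow> dist (X i) (X j) < e"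
      using X e by (meson metric_CauchyD)
    have "(\<Sum>n<N. (coord (X i) n - L n)\<^sup>2) \<le> e\<^sup>2" if i: "i \<ge> M" for i N
    proof (rule LIMSEQ_le_const2)
      show "(\<lambda>j. \<Sum>n<N. (coord (X i) n - coord (X j) n)\<^sup>2)
          \<longlonglongrightarrow> (\<Sum>n<N. (coord (X i) n - L n)\<^sup>2)"
        by (intro tendsto_intros L)
      have "(\<Sum>n<N. (coord (X i) n - coord (X j) n)\<^sup>2) \<le> e\<^sup>2" if "j \<ge> M" for j
      proof -
        have "(\<Sum>n<N. (coord (X i) n - coord (X j) n)\<^sup>2) \<le> (norm (X i - X j))\<^sup>2"
          using norm_ell2_sum_le[where x = "X i - X j"] by simp
        also have "\<dots> \<le> e\<^sup>2"
          using M[OF i that] by (intro power_mono) (simp_all add: dist_norm)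
        finally show ?thesis .
      qed
      then show "\<exists>M. \<forall>j\<ge>M. (\<Sum>n<N. (coord (X i) n - coord (X j) n)\<^sup>2) \<le> e\<^sup>2"
        by blast
    qed
    then show ?thesis
      using ell2_of_bounded_partial_sums e by (metis less_imp_le)
  qed
  obtain M where "(\<lambda>n. coord (X M) n - L n) \<in> square_summable"
    using key[of 1] by auto
  from square_summable_add[OF coord_square_summable[of "X M"] square_summable_scale[OF this, of "-1"]]
  have L2: "L \<in> square_summable"
    by simp
  have diff: "X i - Ell2 L = Ell2 (\<lambda>n. coord (X i) n - L n)" for i
    using L2 by (simp add: minus_ell2_def Ell2_inverse)
  have "X \<longlonglongrightarrow> Ell2 L"
  proof (rule metric_LIMSEQ_I)
    fix e :: real assume "0 < e"
    then show "\<exists>M. \<forall>i\<ge>M. dist (X i) (Ell2 L) < e"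
      using key[of "e / 2"] by (force simp: dist_norm diff)
  qed
  then show "convergent X"
    by (rule convergentI)
qed


section \<open>Smooth maps and differentiable structures\<close>

text \<open>
  For open \<open>S\<close>: all iterated directional derivatives up to order \<open>k\<close> exist and, before the last
  order, are Frechet differentiable in the base point. If \<open>'a\<close> is a Banach space, having this for
  all \<open>k\<close> is the same as being \<open>C\<^sup>\<infinity>\<close> in the Frechet sense, by uniform boundedness.
  Directions are passed one at a time because the target type of the full derivative changes
  with its order.
\<close>

primrec Ck_on ::
  "nat \<Rightarrow> ('a::real_normed_vector \<Rightarrow> 'b::real_normed_vector) \<Rightarrow> 'a set \<Rightarrow> bool"
where
  "Ck_on 0 f S \<longleftrightarrow> continuous_on S f"
| "Ck_on (Suc k) f S \<longleftrightarrow>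
     (\<forall>x\<in>S. f differentiable (at x)) \<and>
     (\<forall>v. Ck_on k (\<lambda>x. frechet_derivative f (at x) v) S)"

text \<open>
  Smoothness on an arbitrary subset of a normed space, as the local existence of smooth extensions.
  The positive part of the unit sphere has empty interior relative to the sphere,
  so its differentiable structure is taken to be the one it has as a subset.
\<close>

definition smooth_on_subset ::
  "'a::real_normed_vector set \<Rightarrow> ('a \<Rightarrow> 'b::real_normed_vector) \<Rightarrow> bool"
where
  "smooth_on_subset A f \<longleftrightarrow>
     (\<forall>a\<in>A. \<exists>W F. open W \<and> a \<in> W \<and> (\<forall>k. Ck_on k F W) \<and> (\<forall>x\<in>A \<inter> W. F x = f x))"

text \<open>
  A differentiable structure on a set \<open>X\<close> is presented by an injective map \<open>\<phi>\<close> from \<open>X\<close> to a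
  normed space; it is the structure for which \<open>\<phi>\<close> is a diffeomorphism onto the subset \<open>\<phi> ` X\<close>.
\<close>

definition smooth_map ::
  "'a set \<Rightarrow> ('a \<Rightarrow> 'e::real_normed_vector) \<Rightarrow> 'b set \<Rightarrow> ('b \<Rightarrow> 'f::real_normed_vector)
    \<Rightarrow> ('a \<Rightarrow> 'b) \<Rightarrow> bool"
where
  "smooth_map X \<phi> Y \<psi> f \<longleftrightarrow>
     f ` X \<subseteq> Y \<and> smooth_on_subset (\<phi> ` X) (\<lambda>z. \<psi> (f (inv_into X \<phi> z)))"

definition diffeomorphism ::
  "'a set \<Rightarrow> ('a \<Rightarrow> 'e::real_normed_vector) \<Rightarrow> 'b set \<Rightarrow> ('b \<Rightarrow> 'f::real_normed_vector)
    \<Rightarrow> ('a \<Rightarrow> 'b) \<Rightarrow> bool"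
where
  "diffeomorphism X \<phi> Y \<psi> f \<longleftrightarrow>
     bij_betw f X Y \<and> smooth_map X \<phi> Y \<psi> f \<and> smooth_map Y \<psi> X \<phi> (inv_into X f)"

definition C1_curve ::
  "'a set \<Rightarrow> ('a \<Rightarrow> 'e::real_normed_vector) \<Rightarrow> (real \<Rightarrow> 'a) \<Rightarrow> bool"
where
  "C1_curve X \<phi> \<gamma> \<longleftrightarrow> (\<forall>t. \<gamma> t \<in> X) \<and> (\<lambda>t. \<phi> (\<gamma> t)) C1_differentiable_on UNIV"

text \<open>
  The differential at \<open>p\<close> of a map from a set \<open>X\<close> of sequences to a normed space: a tangent vector
  \<open>v\<close> is the componentwise derivative at \<open>0\<close> of a curve through \<open>p\<close>, and its image is the
  derivative at \<open>0\<close> of the image curve.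
\<close>

definition differential ::
  "(nat \<Rightarrow> real) set \<Rightarrow> ((nat \<Rightarrow> real) \<Rightarrow> 'e::real_normed_vector)
    \<Rightarrow> ((nat \<Rightarrow> real) \<Rightarrow> 'f::real_normed_vector) \<Rightarrow> (nat \<Rightarrow> real) \<Rightarrow> (nat \<Rightarrow> real) \<Rightarrow> 'f"
where
  "differential X \<phi> f p v =
     (THE w. \<forall>\<gamma>. C1_curve X \<phi> \<gamma> \<and> \<gamma> 0 = p \<and>
        (\<forall>n. ((\<lambda>t. \<gamma> t n) has_real_derivative v n) (at 0)) \<longrightarrow>
        ((\<lambda>t. f (\<gamma> t)) has_vector_derivative w) (at 0))"


section \<open>The positive part of the sphere and the probability simplex\<close>

definition T_sphere :: "ell2 \<Rightarrow> ell2 set"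
  where "T_sphere x = {v. x \<bullet> v = 0}"

definition G_ell2 :: "ell2 \<Rightarrow> ell2 \<Rightarrow> ell2 \<Rightarrow> real"
  where "G_ell2 x v w = v \<bullet> w"

definition U_pos :: "ell2 set"
  where "U_pos = {x \<in> sphere 0 1. \<forall>n. coord x n > 0}"

definition Delta :: "(nat \<Rightarrow> real) set"
  where "Delta = {p \<in> ell1. (\<Sum>n. p n) = 1 \<and> (\<forall>n. p n > 0)}"

definition T_Delta :: "(nat \<Rightarrow> real) \<Rightarrow> (nat \<Rightarrow> real) set"
  where "T_Delta p =
    {v \<in> ell1. (\<Sum>n. v n) = 0 \<and> (\<lambda>n. v n / sqrt (p n)) \<in> square_summable}"

definition G_FR :: "(nat \<Rightarrow> real) \<Rightarrow> (nat \<Rightarrow> real) \<Rightarrow> (nat \<Rightarrow> real) \<Rightarrow> real"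
  where "G_FR p v w = 1/4 * (\<Sum>n. v n * w n / p n)"

definition Phi :: "(nat \<Rightarrow> real) \<Rightarrow> ell2"
  where "Phi p = Ell2 (\<lambda>n. sqrt (p n))"

text \<open>
  By definition of its differentiable structure, a curve in \<open>Delta\<close> is \<open>C\<^sup>1\<close> iff its image
  under \<open>Phi\<close> is.
\<close>

abbreviation dPhi :: "(nat \<Rightarrow> real) \<Rightarrow> (nat \<Rightarrow> real) \<Rightarrow> ell2"
  where "dPhi \<equiv> differential Delta Phi Phi"

end

theory Submission
  imports Defs
begin

text \<open>
  The structure on \<open>Delta\<close> is the one transported along \<open>Phi\<close>, so the diffeomorphism claim reduces to
  smoothness of the identity, and the coordinates of the derivative of \<open>Phi \<circ> \<gamma>\<close> are
  \<open>v n / (2 * sqrt (p n))\<close> by the chain rule. The one delicate point is that every tangent vector is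
  the velocity of a \<open>C\<^sup>1\<close> curve: \<open>U_pos\<close> is not open in the sphere, so great circles may leave it at
  once. Instead, for \<open>x\<close> in \<open>U_pos\<close> and \<open>w\<close> orthogonal to \<open>x\<close>, the curve with coordinates
  \<open>t * w n + sqrt ((t * w n)\<^sup>2 + (x n)\<^sup>2)\<close> is positive for all \<open>t\<close>; it is \<open>C\<^sup>1\<close> in \<open>ell2\<close> by
  dominated convergence, since its velocity is bounded by \<open>2 * \<bar>w n\<bar>\<close>, and normalising it does not
  change its velocity \<open>w\<close> at \<open>0\<close>.
\<close>

section \<open>Dominated convergence in \<open>ell2\<close>\<close>

lemma square_summable_bounded:
  assumes "g \<in> square_summable" "\<And>n. \<bar>f n\<bar> \<le> g n"
  shows "f \<in> square_summable"
proof (rule square_summableI, rule summable_comparison_test')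
  show "summable (\<lambda>n. (g n)\<^sup>2)"
    using assms(1) by (rule square_summableD)
  show "norm ((f n)\<^sup>2) \<le> (g n)\<^sup>2" if "n \<ge> 0" for n
    using power_mono[OF assms(2)[of n], of 2] by simp
qed

lemma square_summable_abs:
  "f \<in> square_summable \<Longrightarrow> (\<lambda>n. \<bar>f n\<bar>) \<in> square_summable"
  by (simp add: square_summable_def)

lemma bounded_linear_coord: "bounded_linear (\<lambda>x. coord x n)"
  by (rule bounded_linear_intro[where K = 1]) (simp_all add: abs_coord_le_norm)

text \<open>Coordinatewise limits alone do not control the tails; the square-summable bound
  \<open>b\<close> does. Tannery's theorem, applied to the squared differences, sends the squared
  distance to 0.\<close>

lemma tendsto_ell2_dominated:
  assumes lim: "\<And>n. ((\<lambda>x. coord (f x) n) \<longlongrightarrow> coord l n) F"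
    and bound: "\<forall>\<^sub>F x in F. \<forall>n. \<bar>coord (f x) n - coord l n\<bar> \<le> b n"
    and b: "b \<in> square_summable" and F: "F \<noteq> bot"
  shows "(f \<longlongrightarrow> l) F"
proof -
  have "((\<lambda>x. \<Sum>n. (coord (f x) n - coord l n)\<^sup>2) \<longlongrightarrow> (\<Sum>n. 0)) F"
  proof (rule tannerys_theorem[THEN conjunct2, THEN conjunct2])
    show "((\<lambda>x. (coord (f x) n - coord l n)\<^sup>2) \<longlongrightarrow> 0) F" for n
      using tendsto_power[OF tendsto_diff[OF lim[of n] tendsto_const[of "coord l n"]], of 2] by simp
    \<comment> \<open>Tannery's theorem asks for the bound along a product filter; here it is
      uniform in \<open>n\<close>, so the factor \<open>at_top\<close> adds no condition.\<close>
    have "\<forall>\<^sub>F (n, x) in at_top \<times>\<^sub>F F. \<forall>n. \<bar>coord (f x) n - coord l n\<bar> \<le> b n"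
      using eventually_prodI[OF eventually_True bound] by (simp add: case_prod_unfold)
    then show "\<forall>\<^sub>F (n, x) in at_top \<times>\<^sub>F F. norm ((coord (f x) n - coord l n)\<^sup>2) \<le> (b n)\<^sup>2"
    proof eventually_elim
      case (elim p)
      then have "\<bar>coord (f (snd p)) (fst p) - coord l (fst p)\<bar> \<le> b (fst p)"
        by (simp add: case_prod_unfold)
      from power_mono[OF this, of 2] show ?case
        by (simp add: case_prod_unfold)
    qed
    show "summable (\<lambda>n. (b n)\<^sup>2)"
      using b by (rule square_summableD)
  qed (fact F)
  then have "((\<lambda>x. (norm (f x - l))\<^sup>2) \<longlongrightarrow> 0) F"
    by (simp add: power2_norm_ell2)
  from tendsto_real_sqrt[OF this] show ?thesis
    by (simp add: tendsto_norm_zero_iff LIM_zero_iff)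
qed

lemma continuous_on_ell2_dominated:
  assumes cont: "\<And>n. continuous_on UNIV (\<lambda>t. coord (y t) n)"
    and bound: "\<And>n t. \<bar>coord (y t) n\<bar> \<le> b n" and b: "b \<in> square_summable"
  shows "continuous_on UNIV (y :: real \<Rightarrow> ell2)"
  unfolding continuous_on_def
proof
  fix t
  show "(y \<longlongrightarrow> y t) (at t)"
  proof (rule tendsto_ell2_dominated)
    show "((\<lambda>t. coord (y t) n) \<longlongrightarrow> coord (y t) n) (at t)" for n
      using cont[of n] by (simp add: continuous_on_def)
    have "\<bar>coord (y s) n - coord (y t) n\<bar> \<le> 2 * b n" for s n
      using bound[of s n] bound[of t n] by linarith
    then show "\<forall>\<^sub>F s in at t. \<forall>n. \<bar>coord (y s) n - coord (y t) n\<bar> \<le> 2 * b n"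
      by simp
    show "(\<lambda>n. 2 * b n) \<in> square_summable"
      using b by (rule square_summable_scale)
  qed simp
qed

text \<open>The mean value inequality bounds each coordinate of the difference quotient by
  \<open>b n\<close>. Its distance to the limit is then at most \<open>2 * b n\<close>, and
  dominated convergence applies.\<close>

lemma has_vector_derivative_ell2_dominated:
  fixes y y' :: "real \<Rightarrow> ell2"
  assumes deriv: "\<And>n t. ((\<lambda>t. coord (y t) n) has_real_derivative coord (y' t) n) (at t)"
    and bound: "\<And>n t. \<bar>coord (y' t) n\<bar> \<le> b n" and b: "b \<in> square_summable"
  shows "(y has_vector_derivative y' t) (at t)"
proof -
  let ?q = "\<lambda>s. (y s - y t) /\<^sub>R (s - t)"
  have "(?q \<longlongrightarrow> y' t) (at t)"
  proof (rule tendsto_ell2_dominated)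
    show "((\<lambda>s. coord (?q s) n) \<longlongrightarrow> coord (y' t) n) (at t)" for n
      using deriv[of n t] by (simp add: has_field_derivative_iff divide_inverse mult.commute)
    have "\<bar>coord (?q s) n - coord (y' t) n\<bar> \<le> 2 * b n" if "s \<noteq> t" for s n
    proof -
      have "\<bar>coord (y s) n - coord (y t) n\<bar> \<le> b n * \<bar>s - t\<bar>"
        using field_differentiable_bound[of UNIV "\<lambda>t. coord (y t) n" "\<lambda>t. coord (y' t) n" "b n" s t]
          deriv bound by simp
      then have "\<bar>coord (y s) n - coord (y t) n\<bar> / \<bar>s - t\<bar> \<le> b n"
        using that by (simp add: pos_divide_le_eq)
      then have "\<bar>coord (?q s) n\<bar> \<le> b n"
        by (simp add: abs_mult abs_inverse divide_inverse mult.commute)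
      then show ?thesis
        using bound[of t n] by linarith
    qed
    then show "\<forall>\<^sub>F s in at t. \<forall>n. \<bar>coord (?q s) n - coord (y' t) n\<bar> \<le> 2 * b n"
      by (auto simp: eventually_at_filter)
    show "(\<lambda>n. 2 * b n) \<in> square_summable"
      using b by (rule square_summable_scale)
  qed simp
  then have "((\<lambda>s. norm (?q s - y' t)) \<longlongrightarrow> 0) (at t)"
    using LIM_zero tendsto_norm_zero by blast
  moreover have "norm (?q s - y' t) = norm (y s - y t - (s - t) *\<^sub>R y' t) / norm (s - t)"
    if "s \<noteq> t" for s
  proof -
    have "?q s - y' t = (y s - y t - (s - t) *\<^sub>R y' t) /\<^sub>R (s - t)"
      using that by (simp add: scaleR_diff_right)
    then show ?thesis
      by (simp only: norm_scaleR) (simp add: divide_inverse mult.commute abs_inverse)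
  qed
  ultimately have "((\<lambda>s. norm (y s - y t - (s - t) *\<^sub>R y' t) / norm (s - t)) \<longlongrightarrow> 0) (at t)"
    by (simp cong: LIM_cong)
  then show ?thesis
    by (simp add: has_vector_derivative_def has_derivative_iff_norm bounded_linear_scaleR_left)
qed

section \<open>Curves in the positive part of the sphere\<close>

text \<open>Each coordinate of the curve is the positive root \<open>s\<close> of
  \<open>s^2 - 2 * t * coord w n * s = (coord x n)^2\<close>, so it cannot reach 0. Unit length is
  left to a later normalisation.\<close>

lemma C1_positive_curve:
  assumes pos: "\<And>n. coord x n > 0"
  obtains y y' :: "real \<Rightarrow> ell2"
  where "y 0 = x" "y' 0 = w" "\<And>t n. coord (y t) n > 0"
    "\<And>t. (y has_vector_derivative y' t) (at t)" "continuous_on UNIV y'"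
proof -
  define r where "r t n = sqrt ((t * coord w n)\<^sup>2 + (coord x n)\<^sup>2)" for t n
  have r: "r t n > 0" "\<bar>t * coord w n\<bar> < r t n" "r t n \<le> \<bar>t * coord w n\<bar> + coord x n" for t n
  proof -
    show "r t n > 0" "\<bar>t * coord w n\<bar> < r t n"
      using pos[of n] by (auto simp: r_def add_nonneg_pos intro!: real_less_rsqrt)
    show "r t n \<le> \<bar>t * coord w n\<bar> + coord x n"
      using pos[of n] sqrt_sum_squares_le_sum_abs[of "t * coord w n" "coord x n"]
      by (simp add: r_def)
  qed
  define f where "f t n = t * coord w n + r t n" for t n
  define f' where "f' t n = coord w n + t * (coord w n)\<^sup>2 / r t n" for t n
  have f'_bound: "\<bar>f' t n\<bar> \<le> 2 * \<bar>coord w n\<bar>" for t n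
  proof -
    \<comment> \<open>As \<open>r t n\<close> exceeds \<open>abs (t * coord w n)\<close>, the second
      summand of \<open>f' t n\<close> is no larger than \<open>abs (coord w n)\<close>.\<close>
    have "\<bar>t * coord w n\<bar> * \<bar>coord w n\<bar> \<le> r t n * \<bar>coord w n\<bar>"
      using r(2)[of t n] by (intro mult_right_mono) auto
    then have "\<bar>t * (coord w n)\<^sup>2 / r t n\<bar> \<le> \<bar>coord w n\<bar>"
      using r(1)[of t n] by (simp add: abs_mult power2_eq_square field_simps)
    then show ?thesis
      unfolding f'_def by linarith
  qed
  have b: "(\<lambda>n. 2 * \<bar>coord w n\<bar>) \<in> square_summable"
    by (intro square_summable_scale square_summable_abs) simp
  have "(\<lambda>n. \<bar>2 * t * coord w n\<bar> + coord x n) \<in> square_summable" for t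
    by (intro square_summable_add square_summable_abs square_summable_scale) simp_all
  moreover have "\<bar>f t n\<bar> \<le> \<bar>2 * t * coord w n\<bar> + coord x n" for t n
    using r[of t n] abs_mult[of 2 "t * coord w n"] unfolding f_def mult.assoc by linarith
  ultimately have "f t \<in> square_summable" for t
    by (rule square_summable_bounded)
  then have y: "coord (Ell2 (f t)) = f t" for t
    by (rule Ell2_inverse)
  have "f' t \<in> square_summable" for t
    using b f'_bound by (rule square_summable_bounded)
  then have y': "coord (Ell2 (f' t)) = f' t" for t
    by (rule Ell2_inverse)
  show thesis
  proof (rule that)
    show "Ell2 (f 0) = x" "Ell2 (f' 0) = w"
      using pos by (auto intro!: ell2_eqI simp: y y' f_def f'_def r_def less_imp_le)
    show "coord (Ell2 (f t)) n > 0" for t n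
      using r(2)[of t n] by (simp add: y f_def)
    have d: "((\<lambda>t. f t n) has_real_derivative f' t n) (at t)" for t n
    proof -
      have "((\<lambda>t. (t * coord w n)\<^sup>2 + (coord x n)\<^sup>2) has_real_derivative 2 * (t * (coord w n)\<^sup>2)) (at t)"
        by (auto intro!: derivative_eq_intros simp: power2_eq_square)
      moreover have "(t * coord w n)\<^sup>2 + (coord x n)\<^sup>2 > 0"
        using r(1)[of t n] by (simp add: r_def)
      ultimately have "((\<lambda>t. r t n) has_real_derivative
          inverse (r t n) / 2 * (2 * (t * (coord w n)\<^sup>2))) (at t)"
        unfolding r_def by (metis DERIV_chain2 DERIV_real_sqrt)
      then have "((\<lambda>t. r t n) has_real_derivative t * (coord w n)\<^sup>2 / r t n) (at t)"
        using r(1)[of t n] by (elim DERIV_cong) (simp add: field_simps)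
      then show ?thesis
        unfolding f_def f'_def by (intro DERIV_add) (auto intro!: derivative_eq_intros)
    qed
    show "((\<lambda>t. Ell2 (f t)) has_vector_derivative Ell2 (f' t)) (at t)" for t
      by (rule has_vector_derivative_ell2_dominated[OF _ _ b]) (simp_all add: y y' d f'_bound)
    have "continuous_on UNIV (\<lambda>t. f' t n)" for n
      using r(1)[of _ n, THEN less_imp_neq] unfolding f'_def r_def
      by (intro continuous_intros) (metis less_irrefl)
    then show "continuous_on UNIV (\<lambda>t. Ell2 (f' t))"
      by (intro continuous_on_ell2_dominated[OF _ _ b]) (simp_all add: y' f'_bound)
  qed
qed

text \<open>Dividing by the norm keeps all coordinates positive and moves the positive curve onto
  the sphere.\<close>

lemma C1_curve_U_pos:
  assumes x: "x \<in> U_pos" and w: "w \<in> T_sphere x"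
  obtains c where "C1_curve U_pos id c" "c 0 = x" "(c has_vector_derivative w) (at 0)"
proof -
  have pos: "coord x n > 0" for n
    using x by (simp add: U_pos_def)
  obtain y y' where y: "y 0 = x" "y' 0 = w" "\<And>t n. coord (y t) n > 0"
    and d: "\<And>t. (y has_vector_derivative y' t) (at t)" and y': "continuous_on UNIV y'"
    using C1_positive_curve[OF pos, where w = w] by blast
  have nz: "y t \<noteq> 0" for t
    using y(3)[of t 0] by auto
  define c where "c t = inverse (norm (y t)) *\<^sub>R y t" for t
  \<comment> \<open>Product rule: the scalar in the second summand is the derivative of
    \<open>inverse (norm (y t))\<close>.\<close>
  define c' where "c' t = inverse (norm (y t)) *\<^sub>R y' t
    + (- (y t \<bullet> y' t) / (norm (y t))^3) *\<^sub>R y t" for t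
  have c: "(c has_vector_derivative c' t) (at t)" for t
  proof -
    have "((\<lambda>t. y t \<bullet> y t) has_derivative (\<lambda>h. y t \<bullet> (h *\<^sub>R y' t) + (h *\<^sub>R y' t) \<bullet> y t)) (at t)"
      using d[of t] unfolding has_vector_derivative_def by (intro has_derivative_inner)
    then have d_inner: "((\<lambda>t. y t \<bullet> y t) has_real_derivative 2 * (y t \<bullet> y' t)) (at t)"
      unfolding has_field_derivative_def
      by (rule has_derivative_eq_rhs) (simp add: inner_commute[of "y' t"] fun_eq_iff)
    have pos_inner: "y t \<bullet> y t > 0"
      using nz[of t] by simp
    have "((\<lambda>t. norm (y t)) has_real_derivative (y t \<bullet> y' t) / norm (y t)) (at t)"
      unfolding norm_eq_sqrt_inner
      by (rule DERIV_cong[OF DERIV_chain2[OF DERIV_real_sqrt[OF pos_inner] d_inner]])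
        (simp only: divide_inverse mult.assoc, simp)
    moreover have "norm (y t) \<noteq> 0"
      using nz[of t] by simp
    ultimately have "((\<lambda>t. inverse (norm (y t))) has_real_derivative - (y t \<bullet> y' t) / (norm (y t))^3) (at t)"
      by (rule DERIV_cong[OF DERIV_inverse_fun])
        (simp add: power3_eq_cube divide_inverse mult.assoc)
    from has_vector_derivative_scaleR[OF this d] show ?thesis
      by (simp add: c_def[abs_def] c'_def)
  qed
  have "continuous_on UNIV y"
    using d by (meson continuous_at_imp_continuous_on has_vector_derivative_continuous)
  then have "continuous_on UNIV c'"
    unfolding c'_def using nz y' by (intro continuous_intros) auto
  then have "c C1_differentiable_on UNIV"
    using c unfolding C1_differentiable_on_def by blast
  moreover have "c t \<in> U_pos" for t
    using nz[of t] y(3)[of t] by (auto simp: U_pos_def c_def)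
  moreover have "norm x = 1"
    using x by (simp add: U_pos_def)
  \<comment> \<open>At 0 the norm is 1 and \<open>x\<close> is orthogonal to \<open>w\<close>, so
    the second summand of \<open>c'\<close> vanishes.\<close>
  then have "c 0 = x" "c' 0 = w"
    using w by (simp_all add: c_def c'_def y T_sphere_def)
  ultimately show thesis
    using that[of c] c[of 0] by (simp add: C1_curve_def)
qed

section \<open>The square-root map\<close>

lemma Delta_iff: "p \<in> Delta \<longleftrightarrow> (\<forall>n. p n > 0) \<and> p sums 1"
proof -
  have "summable (\<lambda>n. \<bar>p n\<bar>) \<longleftrightarrow> summable p" if "\<forall>n. p n > 0"
    using that by (simp add: less_imp_le)
  then show ?thesis
    by (auto simp: Delta_def ell1_def sums_iff)
qed

lemma coord_Phi:
  assumes "p \<in> Delta"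
  shows "coord (Phi p) n = sqrt (p n)"
proof -
  have "(\<lambda>n. sqrt (p n)) \<in> square_summable"
    using assms by (auto simp: square_summable_def Delta_iff less_imp_le sums_iff)
  then show ?thesis
    by (simp add: Phi_def Ell2_inverse)
qed

lemma U_pos_iff: "x \<in> U_pos \<longleftrightarrow> (\<forall>n. coord x n > 0) \<and> (\<lambda>n. (coord x n)\<^sup>2) sums 1"
proof -
  have "norm x = 1 \<longleftrightarrow> (\<Sum>n. (coord x n)\<^sup>2) = 1"
    using power2_eq_1_iff[of "norm x"] norm_ge_zero[of x] by (auto simp flip: power2_norm_ell2)
  then show ?thesis
    by (auto simp: U_pos_def sums_iff square_summableD)
qed

text \<open>Squaring coordinates inverts the root because both sides are positive, and total mass 1
  corresponds to norm 1.\<close>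

lemma bij_betw_Phi: "bij_betw Phi Delta U_pos"
proof (rule bij_betw_byWitness[where f' = "\<lambda>x n. (coord x n)\<^sup>2"])
  show "\<forall>p\<in>Delta. (\<lambda>n. (coord (Phi p) n)\<^sup>2) = p"
    by (auto simp: coord_Phi Delta_iff less_imp_le)
  show D: "(\<lambda>x n. (coord x n)\<^sup>2) ` U_pos \<subseteq> Delta"
    by (auto simp: Delta_iff U_pos_iff) (metis less_irrefl)
  show "\<forall>x\<in>U_pos. Phi (\<lambda>n. (coord x n)\<^sup>2) = x"
  proof
    fix x assume "x \<in> U_pos"
    then show "Phi (\<lambda>n. (coord x n)\<^sup>2) = x"
      using D by (auto intro!: ell2_eqI simp: coord_Phi image_subset_iff U_pos_iff less_imp_le)
  qed
  show "Phi ` Delta \<subseteq> U_pos"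
    by (auto simp: U_pos_iff coord_Phi) (auto simp: Delta_iff less_imp_le)
qed

section \<open>Smoothness in the transported structure\<close>

lemma Ck_on_const: "Ck_on k (\<lambda>x. c) S"
  by (induction k arbitrary: c) auto

lemma Ck_on_ident: "Ck_on k (\<lambda>x. x) S"
  by (cases k) (auto simp: Ck_on_const)

text \<open>The identity of the whole space serves as the local smooth extension at every
  point.\<close>

lemma smooth_on_subset_ident:
  assumes "\<And>x. x \<in> A \<Longrightarrow> f x = x"
  shows "smooth_on_subset A f"
  unfolding smooth_on_subset_def
  using assms Ck_on_ident by (metis IntD1 UNIV_I open_UNIV)

text \<open>Read through \<open>Phi\<close> on \<open>Delta\<close> and \<open>id\<close> on
  \<open>U_pos\<close>, both the map and its inverse become the identity of
  \<open>U_pos\<close>.\<close>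

lemma diffeomorphism_Phi: "diffeomorphism Delta Phi U_pos id Phi"
proof -
  have "inv_into Delta Phi z \<in> Delta" "Phi (inv_into Delta Phi z) = z" if "z \<in> U_pos" for z
    using that bij_betw_Phi by (auto simp: bij_betw_def inv_into_into f_inv_into_f)
  moreover have "inv_into U_pos id z = z" if "z \<in> U_pos" for z
    using inv_into_f_f[of id U_pos z] that by simp
  moreover have "Phi ` Delta = U_pos"
    using bij_betw_Phi by (simp add: bij_betw_def)
  ultimately show ?thesis
    using bij_betw_Phi
    by (auto simp: diffeomorphism_def smooth_map_def intro!: smooth_on_subset_ident)
qed

section \<open>The differential\<close>

text \<open>The componentwise derivative of the square root, named so that it can be studied before
  the description operator in \<open>differential\<close> is evaluated.\<close>

definition half_quotient :: "(nat \<Rightarrow> real) \<Rightarrow> (nat \<Rightarrow> real) \<Rightarrow> ell2"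
  where "half_quotient p v = Ell2 (\<lambda>n. v n / (2 * sqrt (p n)))"

lemma coord_half_quotient:
  assumes "v \<in> T_Delta p"
  shows "coord (half_quotient p v) n = v n / (2 * sqrt (p n))"
proof -
  have "(\<lambda>n. 1/2 * (v n / sqrt (p n))) \<in> square_summable"
    using assms by (intro square_summable_scale) (simp add: T_Delta_def)
  then show ?thesis
    by (simp add: half_quotient_def Ell2_inverse)
qed

text \<open>The roots cancel in the inner product with \<open>Phi p\<close>, which leaves half the
  sum of \<open>v\<close>, that is 0.\<close>

lemma half_quotient_tangent:
  assumes p: "p \<in> Delta" and v: "v \<in> T_Delta p"
  shows "half_quotient p v \<in> T_sphere (Phi p)"
proof -
  have "coord (Phi p) n * coord (half_quotient p v) n = v n / 2" for n
    using p by (simp add: coord_Phi coord_half_quotient v Delta_iff less_imp_neq[THEN not_sym])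
  then have "Phi p \<bullet> half_quotient p v = (\<Sum>n. v n / 2)"
    by (simp only: inner_ell2_def)
  moreover have "summable v" "suminf v = 0"
    using v by (auto simp: T_Delta_def ell1_def summable_rabs_cancel)
  ultimately show ?thesis
    by (simp add: T_sphere_def suminf_divide)
qed

lemma bij_betw_half_quotient:
  assumes p: "p \<in> Delta"
  shows "bij_betw (half_quotient p) (T_Delta p) (T_sphere (Phi p))"
proof (rule bij_betw_byWitness[where f' = "\<lambda>w n. 2 * sqrt (p n) * coord w n"])
  have pos: "p n > 0" for n
    using p by (simp add: Delta_iff)
  show "\<forall>v\<in>T_Delta p. (\<lambda>n. 2 * sqrt (p n) * coord (half_quotient p v) n) = v"
    using pos by (auto simp: coord_half_quotient less_imp_neq[THEN not_sym])
  show D: "(\<lambda>w n. 2 * sqrt (p n) * coord w n) ` T_sphere (Phi p) \<subseteq> T_Delta p"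
  proof safe
    fix w assume w: "w \<in> T_sphere (Phi p)"
    \<comment> \<open>The preimage of \<open>w\<close> is absolutely summable as a product of two
      square-summable sequences; its sum is \<open>2 * (Phi p \<bullet> w)\<close>, which vanishes
      by tangency.\<close>
    have "(\<lambda>n. sqrt (p n)) \<in> square_summable"
      using coord_square_summable[of "Phi p"] by (simp add: coord_Phi[OF p, abs_def])
    then have "summable (\<lambda>n. 2 * (\<bar>sqrt (p n)\<bar> * \<bar>coord w n\<bar>))"
      by (intro summable_mult square_summable_mult square_summable_abs) simp_all
    then have "summable (\<lambda>n. \<bar>2 * sqrt (p n) * coord w n\<bar>)"
      by (simp add: abs_mult mult.assoc)
    moreover have "(\<Sum>n. 2 * sqrt (p n) * coord w n) = 2 * (Phi p \<bullet> w)"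
      by (simp only: inner_ell2_def mult.assoc coord_Phi[OF p, symmetric])
        (simp add: suminf_mult)
    moreover have "(\<lambda>n. 2 * sqrt (p n) * coord w n / sqrt (p n)) = (\<lambda>n. 2 * coord w n)"
      using pos by (auto simp: less_imp_neq[THEN not_sym])
    ultimately show "(\<lambda>n. 2 * sqrt (p n) * coord w n) \<in> T_Delta p"
      using w by (simp add: T_Delta_def ell1_def T_sphere_def square_summable_scale)
  qed
  show "\<forall>w\<in>T_sphere (Phi p). half_quotient p (\<lambda>n. 2 * sqrt (p n) * coord w n) = w"
    using D pos
    by (auto intro!: ell2_eqI simp: coord_half_quotient image_subset_iff less_imp_neq[THEN not_sym])
  show "half_quotient p ` T_Delta p \<subseteq> T_sphere (Phi p)"
    using p half_quotient_tangent by blast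
qed

text \<open>Without such a curve the condition that defines \<open>differential\<close> would be
  vacuous and fix no vector. It is the squared image of a curve in \<open>U_pos\<close> with
  velocity \<open>half_quotient p v\<close>.\<close>

lemma curve_with_velocity:
  assumes p: "p \<in> Delta" and v: "v \<in> T_Delta p"
  obtains \<gamma> where "C1_curve Delta Phi \<gamma>" "\<gamma> 0 = p"
    "\<And>n. ((\<lambda>t. \<gamma> t n) has_real_derivative v n) (at 0)"
proof -
  have pos: "p n > 0" for n
    using p by (simp add: Delta_iff)
  have "Phi p \<in> U_pos"
    using p bij_betw_Phi by (auto simp: bij_betw_def)
  then obtain c where c: "C1_curve U_pos id c" "c 0 = Phi p"
    and d: "(c has_vector_derivative half_quotient p v) (at 0)"
    using C1_curve_U_pos half_quotient_tangent[OF p v] by blast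
  define \<gamma> where "\<gamma> t n = (coord (c t) n)\<^sup>2" for t n
  have U: "c t \<in> U_pos" for t
    using c(1) by (simp add: C1_curve_def)
  have D: "\<gamma> t \<in> Delta" for t
    using U[of t] unfolding Delta_iff U_pos_iff \<gamma>_def
    by (blast intro: zero_less_power)
  have "Phi (\<gamma> t) = c t" for t
    using U[of t] by (auto intro!: ell2_eqI simp: coord_Phi[OF D] \<gamma>_def U_pos_iff less_imp_le)
  then have "C1_curve Delta Phi \<gamma>"
    using c(1) D by (simp add: C1_curve_def)
  moreover have "\<gamma> 0 = p"
    using pos by (auto simp: \<gamma>_def c coord_Phi p less_imp_le)
  moreover have "((\<lambda>t. \<gamma> t n) has_real_derivative v n) (at 0)" for n
  proof -
    have "((\<lambda>t. coord (c t) n) has_real_derivative v n / (2 * sqrt (p n))) (at 0)"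
      using bounded_linear.has_vector_derivative[OF bounded_linear_coord d, of n]
      by (simp add: coord_half_quotient v has_real_derivative_iff_has_vector_derivative)
    \<comment> \<open>The factor \<open>2 * sqrt (p n)\<close> from squaring cancels the
      denominator.\<close>
    from DERIV_power[OF this, of 2] show ?thesis
      using pos[of n] by (simp add: \<gamma>_def c coord_Phi p)
  qed
  ultimately show thesis
    using that by blast
qed

lemma has_vector_derivative_Phi_curve:
  assumes \<gamma>: "C1_curve Delta Phi \<gamma>" and v: "v \<in> T_Delta (\<gamma> 0)"
    and d: "\<And>n. ((\<lambda>t. \<gamma> t n) has_real_derivative v n) (at 0)"
  shows "((\<lambda>t. Phi (\<gamma> t)) has_vector_derivative half_quotient (\<gamma> 0) v) (at 0)"
proof -
  have D: "\<gamma> t \<in> Delta" for t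
    using \<gamma> by (simp add: C1_curve_def)
  \<comment> \<open>A derivative in \<open>ell2\<close> exists because \<open>C1_curve\<close> is
    defined through \<open>Phi\<close>; it remains to identify its coordinates by the chain
    rule.\<close>
  obtain w where w: "((\<lambda>t. Phi (\<gamma> t)) has_vector_derivative w) (at 0)"
    using \<gamma> unfolding C1_curve_def C1_differentiable_on_def by blast
  have "w = half_quotient (\<gamma> 0) v"
  proof (rule ell2_eqI)
    fix n
    have pos: "\<gamma> 0 n > 0"
      using D[of 0] by (simp add: Delta_iff)
    have "((\<lambda>t. sqrt (\<gamma> t n)) has_real_derivative coord w n) (at 0)"
      using bounded_linear.has_vector_derivative[OF bounded_linear_coord w, of n]
      by (simp add: coord_Phi D has_real_derivative_iff_has_vector_derivative)
    moreover have "((\<lambda>t. sqrt (\<gamma> t n)) has_real_derivative inverse (sqrt (\<gamma> 0 n)) / 2 * v n) (at 0)"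
      using DERIV_chain2[OF DERIV_real_sqrt[OF pos] d[of n]] .
    ultimately have "coord w n = inverse (sqrt (\<gamma> 0 n)) / 2 * v n"
      by (rule DERIV_unique)
    then show "coord w n = coord (half_quotient (\<gamma> 0) v) n"
      using pos by (simp add: coord_half_quotient[OF v] field_simps)
  qed
  then show ?thesis
    using w by simp
qed

text \<open>Every admissible curve has this image velocity, and one admissible curve exists, so
  uniqueness of vector derivatives determines the description.\<close>

lemma dPhi_eq:
  assumes p: "p \<in> Delta" and v: "v \<in> T_Delta p"
  shows "dPhi p v = half_quotient p v"
proof -
  let ?P = "\<lambda>\<gamma>. C1_curve Delta Phi \<gamma> \<and> \<gamma> 0 = p \<and>
    (\<forall>n. ((\<lambda>t. \<gamma> t n) has_real_derivative v n) (at 0))"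
  have *: "((\<lambda>t. Phi (\<gamma> t)) has_vector_derivative half_quotient p v) (at 0)" if "?P \<gamma>" for \<gamma>
    using has_vector_derivative_Phi_curve[of \<gamma> v] that v by simp
  obtain \<gamma> where \<gamma>: "?P \<gamma>"
    using curve_with_velocity[OF p v] by metis
  show ?thesis
    unfolding differential_def
  proof (rule the_equality)
    show "\<forall>\<gamma>. ?P \<gamma> \<longrightarrow> ((\<lambda>t. Phi (\<gamma> t)) has_vector_derivative half_quotient p v) (at 0)"
      using * by blast
  next
    fix w assume "\<forall>\<gamma>. ?P \<gamma> \<longrightarrow> ((\<lambda>t. Phi (\<gamma> t)) has_vector_derivative w) (at 0)"
    then have "((\<lambda>t. Phi (\<gamma> t)) has_vector_derivative w) (at 0)"
      using \<gamma> by blast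
    then show "w = half_quotient p v"
      using *[OF \<gamma>] by (rule vector_derivative_unique_at)
  qed
qed

section \<open>Comparison of the metrics\<close>

lemma G_ell2_half_quotient:
  assumes p: "p \<in> Delta" and v: "v \<in> T_Delta p" and w: "w \<in> T_Delta p"
  shows "G_ell2 (Phi p) (half_quotient p v) (half_quotient p w) = G_FR p v w"
proof -
  \<comment> \<open>The two denominators \<open>2 * sqrt (p n)\<close> multiply to
    \<open>4 * p n\<close>, the source of the factor 1/4.\<close>
  have eq: "coord (half_quotient p v) n * coord (half_quotient p w) n = 1/4 * (v n * w n / p n)" for n
    using p by (simp add: coord_half_quotient v w Delta_iff less_imp_le field_simps)
  \<comment> \<open>Convergence of the Fisher-Rao series is read off from \<open>ell2\<close>, so
    that 1/4 may be moved out of the sum.\<close>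
  have "summable (\<lambda>n. 4 * (coord (half_quotient p v) n * coord (half_quotient p w) n))"
    by (intro summable_mult summable_coord_mult)
  then have "summable (\<lambda>n. v n * w n / p n)"
    by (simp only: eq) simp
  from suminf_mult[OF this, of "1/4"] show ?thesis
    unfolding G_ell2_def G_FR_def inner_ell2_def eq by simp
qed

theorem theorem1:
  shows "diffeomorphism Delta Phi U_pos id Phi \<and>
    (\<forall>p\<in>Delta. bij_betw (dPhi p) (T_Delta p) (T_sphere (Phi p)) \<and>
      (\<forall>v\<in>T_Delta p. \<forall>w\<in>T_Delta p.
         G_ell2 (Phi p) (dPhi p v) (dPhi p w) = G_FR p v w))"
proof (intro conjI ballI)
  fix p assume p: "p \<in> Delta"
  show "bij_betw (dPhi p) (T_Delta p) (T_sphere (Phi p))"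
    \<comment> \<open>\<open>dPhi p\<close> is identified only on tangent vectors, hence the
      transfer by congruence on \<open>T_Delta p\<close>.\<close>
    using bij_betw_half_quotient[OF p] bij_betw_cong[of "T_Delta p" "dPhi p" "half_quotient p"]
      dPhi_eq[OF p] by simp
next
  fix p v w assume "p \<in> Delta" "v \<in> T_Delta p" "w \<in> T_Delta p"
  then show "G_ell2 (Phi p) (dPhi p v) (dPhi p w) = G_FR p v w"
    by (simp add: dPhi_eq G_ell2_half_quotient)
qed (rule diffeomorphism_Phi)

end
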